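(* Let $p$ be a prime and let $\alpha$ be a multiplicative arithmetic function, considered locally at $p$. (1) $\alpha$ is of type 1, i.e. $(\mathrm{fin},\mathrm{fin})$, at $p$ if and only if $\alpha$ is the convolution identity at $p$ (that is, $\alpha(p^n)=0$ for all $n\ge1$). (2) If $\alpha$ is positive at $p$, then it is of type 2, i.e. $(\infty,\mathrm{fin})$; if $\alpha$ is negative at $p$, then it is of type 3, i.e. $(\mathrm{fin},\infty)$.
   Context: A multiplicative arithmetic function is a function $\alpha:\mathbb{N}_{\ge1}\to\mathbb{C}$, not identically zero, with $\alpha(mn)=\alpha(m)\alpha(n)$ whenever $\gcd(m,n)=1$; it is completely multiplicative if this holds for all $m,n$. Dirichlet convolution is $(\alpha*\beta)(n)=\sum_{d\mid n}\alpha(d)\beta(n/d)$. Generalized Fibonacci polynomials: $F_0=1$ and, for $n\ge1$, $F_n(t_1,\dots,t_n)=\sum\binom{a_1+\dots+a_n}{a_1,\dots,a_n}t_1^{a_1}\cdots t_n^{a_n}$, the sum being over tuples of non-negative integers with $\sum_j ja_j=n$. The parameters of $\alpha$ at $p$ are the unique complex numbers $t_1,t_2,\dots$ such that $F_n(t_1,\dots,t_n)=\alpha(p^n)$ for all $n\ge0$. Type of $\alpha$ at $p$: the pair (range, domain), where the range is "fin" if $\alpha(p^n)=0$ for all sufficiently large $n$ and "$\infty$" otherwise, and the domain is "fin" if $t_j=0$ for all sufficiently large $j$ and "$\infty$" otherwise. Type 1 is $(\mathrm{fin},\mathrm{fin})$, type 2 is $(\infty,\mathrm{fin})$, type 3 is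 $(\mathrm{fin},\infty)$, type 4 is $(\infty,\infty)$. $\alpha$ is positive at $p$ if, on powers of $p$, it is a convolution product of $r\ge1$ completely multiplicative functions of degree 1 at $p$, i.e. completely multiplicative functions $\beta$ with $\beta(p)\ne0$. It is negative at $p$ if it is the convolution inverse of such a product. *)

theory Defs
  imports Complex_Main "HOL-Computational_Algebra.Primes" "HOL-Library.FuncSet"
begin

text \<open>
  Arithmetic functions are represented as functions on all of \<open>nat\<close>; the value at \<open>0\<close> is junk
  and is never used.
\<close>

definition multiplicative_fun :: "(nat \<Rightarrow> complex) \<Rightarrow> bool" where
  "multiplicative_fun \<alpha> \<longleftrightarrow>
     (\<exists>n\<ge>1. \<alpha> n \<noteq> 0) \<and> (\<forall>m\<ge>1. \<forall>n\<ge>1. coprime m n \<longrightarrow> \<alpha> (m * n) = \<alpha> m * \<alpha> n)"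

definition completely_multiplicative_fun :: "(nat \<Rightarrow> complex) \<Rightarrow> bool" where
  "completely_multiplicative_fun \<alpha> \<longleftrightarrow>
     (\<exists>n\<ge>1. \<alpha> n \<noteq> 0) \<and> (\<forall>m\<ge>1. \<forall>n\<ge>1. \<alpha> (m * n) = \<alpha> m * \<alpha> n)"

definition dirichlet_conv :: "(nat \<Rightarrow> complex) \<Rightarrow> (nat \<Rightarrow> complex) \<Rightarrow> nat \<Rightarrow> complex" where
  "dirichlet_conv \<alpha> \<beta> n = (\<Sum>d | d dvd n. \<alpha> d * \<beta> (n div d))"

definition conv_id :: "nat \<Rightarrow> complex" where
  "conv_id n = (if n = 1 then 1 else 0)"

text \<open>
  Generalized Fibonacci polynomials. Only \<open>t 1, \<dots>, t n\<close> enter the value; the tuples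
  \<open>(a\<^sub>1, \<dots>, a\<^sub>n)\<close> are extensional functions on \<open>{1..n}\<close>, so that each is counted once.
\<close>

definition fib_tuples :: "nat \<Rightarrow> (nat \<Rightarrow> nat) set" where
  "fib_tuples n = {a \<in> {1..n} \<rightarrow>\<^sub>E UNIV. (\<Sum>j=1..n. j * a j) = n}"

definition gen_fib :: "nat \<Rightarrow> (nat \<Rightarrow> complex) \<Rightarrow> complex" where
  "gen_fib n t =
     (\<Sum>a\<in>fib_tuples n.
        fact (\<Sum>j=1..n. a j) / (\<Prod>j=1..n. fact (a j)) * (\<Prod>j=1..n. t j ^ a j))"

text \<open>The index \<open>0\<close> carries no parameter; it is set to \<open>0\<close> so that the sequence is unique.\<close>

definition is_params :: "(nat \<Rightarrow> complex) \<Rightarrow> nat \<Rightarrow> (nat \<Rightarrow> complex) \<Rightarrow> bool" where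
  "is_params \<alpha> p t \<longleftrightarrow> t 0 = 0 \<and> (\<forall>n. gen_fib n t = \<alpha> (p ^ n))"

definition params :: "(nat \<Rightarrow> complex) \<Rightarrow> nat \<Rightarrow> nat \<Rightarrow> complex" where
  "params \<alpha> p = (THE t. is_params \<alpha> p t)"

datatype extent = Finite_Extent | Infinite_Extent

definition extent_of :: "(nat \<Rightarrow> complex) \<Rightarrow> extent" where
  "extent_of f = (if \<exists>N. \<forall>n\<ge>N. f n = 0 then Finite_Extent else Infinite_Extent)"

text \<open>The pair (range, domain).\<close>

definition type_at :: "(nat \<Rightarrow> complex) \<Rightarrow> nat \<Rightarrow> extent \<times> extent" where
  "type_at \<alpha> p = (extent_of (\<lambda>n. \<alpha> (p ^ n)), extent_of (params \<alpha> p))"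

definition positive_at :: "(nat \<Rightarrow> complex) \<Rightarrow> nat \<Rightarrow> bool" where
  "positive_at \<alpha> p \<longleftrightarrow>
     (\<exists>\<beta>s. \<beta>s \<noteq> [] \<and>
        (\<forall>\<beta>\<in>set \<beta>s. completely_multiplicative_fun \<beta> \<and> \<beta> p \<noteq> 0) \<and>
        (\<forall>k. \<alpha> (p ^ k) = foldr dirichlet_conv \<beta>s conv_id (p ^ k)))"

text \<open>
  For prime \<open>p\<close>, the values of a convolution at powers of \<open>p\<close> only involve values of the factors
  at powers of \<open>p\<close>, so being inverse to each other is a meaningful local condition.
\<close>

definition negative_at :: "(nat \<Rightarrow> complex) \<Rightarrow> nat \<Rightarrow> bool" where
  "negative_at \<alpha> p \<longleftrightarrow>
     (\<exists>\<gamma>. positive_at \<gamma> p \<and> (\<forall>k. dirichlet_conv \<alpha> \<gamma> (p ^ k) = conv_id (p ^ k)))"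


subsection \<open>The parameters exist and are unique\<close>

lemma finite_fib_tuples: "finite (fib_tuples n)"
proof (rule finite_subset)
  show "fib_tuples n \<subseteq> {1..n} \<rightarrow>\<^sub>E {0..n}"
  proof
    fix a assume a: "a \<in> fib_tuples n"
    have "a i \<le> n" if i: "i \<in> {1..n}" for i
    proof -
      have "a i \<le> i * a i" using i by simp
      also have "\<dots> \<le> (\<Sum>j=1..n. j * a j)"
        by (rule member_le_sum[OF i, of "\<lambda>j. j * a j"]) auto
      finally show ?thesis using a by (simp add: fib_tuples_def)
    qed
    then show "a \<in> {1..n} \<rightarrow>\<^sub>E {0..n}" using a by (auto simp: fib_tuples_def PiE_iff)
  qed
  show "finite ({1..n} \<rightarrow>\<^sub>E {0..n})" by (intro finite_PiE) auto
qed

lemma gen_fib_0: "gen_fib 0 t = 1"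
  by (simp add: gen_fib_def fib_tuples_def)

lemma gen_fib_cong:
  assumes "\<And>j. 1 \<le> j \<Longrightarrow> j \<le> n \<Longrightarrow> s j = t j"
  shows "gen_fib n s = gen_fib n t"
  unfolding gen_fib_def using assms by (intro sum.cong arg_cong2[where f = "(*)"] prod.cong) auto

lemma gen_fib_rec:
  assumes n: "n \<ge> 1"
  shows "gen_fib n t = t n + gen_fib n (t(n := 0))"
proof -
  define M where "M = (\<lambda>s::nat \<Rightarrow> complex. \<lambda>a::nat \<Rightarrow> nat.
    fact (\<Sum>j=1..n. a j) / (\<Prod>j=1..n. fact (a j)) * (\<Prod>j=1..n. s j ^ a j))"
  define u where "u = (\<lambda>j\<in>{1..n}. if j = n then 1 else 0 :: nat)"
  have split: "{1..n} = insert n {1..<n}" using n by auto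
  have u: "u \<in> fib_tuples n"
  proof -
    have "(\<Sum>j=1..n. j * u j) = (\<Sum>j=1..n. if j = n then n else 0)"
      by (rule sum.cong) (auto simp: u_def)
    then show ?thesis using n by (auto simp: fib_tuples_def u_def)
  qed
  have sum_u: "(\<Sum>j=1..n. u j) = 1"
  proof -
    have "(\<Sum>j=1..n. u j) = (\<Sum>j=1..n. if j = n then 1 else 0)"
      by (rule sum.cong) (auto simp: u_def)
    then show ?thesis using n by simp
  qed
  have fact_u: "(\<Prod>j=1..n. fact (u j)) = (1::complex)"
    by (rule prod.neutral) (auto simp: u_def)
  have pow_u: "(\<Prod>j=1..n. s j ^ u j) = s n" for s :: "nat \<Rightarrow> complex"
  proof -
    have "(\<Prod>j=1..n. s j ^ u j) = (\<Prod>j=1..n. if j = n then s j else 1)"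
      by (rule prod.cong) (auto simp: u_def)
    then show ?thesis using n by simp
  qed
  have M_u: "M s u = s n" for s by (simp only: M_def sum_u fact_u pow_u) simp
  have rest: "M t a = M (t(n := 0)) a" if a: "a \<in> fib_tuples n - {u}" for a
  proof -
    have ext: "a \<in> extensional {1..n}" and s: "(\<Sum>j=1..n. j * a j) = n"
      using a by (auto simp: fib_tuples_def PiE_def)
    have "a n = 0"
    proof (rule ccontr)
      assume nz: "a n \<noteq> 0"
      have eq: "n * a n + (\<Sum>j\<in>{1..<n}. j * a j) = n" using s by (subst (asm) split) simp
      moreover have "n * a n \<ge> n" using nz by simp
      ultimately have "(\<Sum>j\<in>{1..<n}. j * a j) = 0" "n * a n = n" by linarith+
      then have "a j = 0" if "1 \<le> j" "j < n" for j using that by auto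
      moreover have "a n = 1" using \<open>n * a n = n\<close> n by simp
      ultimately have "a = u"
        by (intro extensionalityI[OF ext, of u]) (auto simp: u_def le_less)
      then show False using a by simp
    qed
    then have "(\<Prod>j=1..n. t j ^ a j) = (\<Prod>j=1..n. (t(n := 0)) j ^ a j)"
      by (intro prod.cong) auto
    then show ?thesis by (simp only: M_def)
  qed
  have F: "gen_fib n s = M s u + sum (M s) (fib_tuples n - {u})" for s
    unfolding gen_fib_def using sum.remove[OF finite_fib_tuples u, of "M s"] by (simp add: M_def)
  have "sum (M t) (fib_tuples n - {u}) = sum (M (t(n := 0))) (fib_tuples n - {u})"
    by (rule sum.cong[OF refl rest])
  then show ?thesis using F[of t] F[of "t(n := 0)"] M_u by simp
qed

fun params_rec :: "(nat \<Rightarrow> complex) \<Rightarrow> nat \<Rightarrow> nat \<Rightarrow> complex" where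
  "params_rec \<alpha> p n = (if n = 0 then 0
     else \<alpha> (p ^ n) - gen_fib n (\<lambda>j. if j < n then params_rec \<alpha> p j else 0))"

declare params_rec.simps [simp del]

lemma ex1_is_params:
  assumes "\<alpha> 1 = 1"
  shows "\<exists>!t. is_params \<alpha> p t"
proof
  define t where "t = params_rec \<alpha> p"
  have "gen_fib n t = \<alpha> (p ^ n)" for n
  proof (cases "n = 0")
    case False
    have "gen_fib n (t(n := 0)) = gen_fib n (\<lambda>j. if j < n then t j else 0)"
      by (rule gen_fib_cong) auto
    moreover have "t n = \<alpha> (p ^ n) - gen_fib n (\<lambda>j. if j < n then t j else 0)"
      unfolding t_def using False params_rec.simps[of \<alpha> p n] by simp
    ultimately show ?thesis using False gen_fib_rec[of n t] by simp
  qed (use assms in \<open>simp add: gen_fib_0\<close>)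
  moreover have "t 0 = 0" by (simp add: t_def params_rec.simps)
  ultimately show t: "is_params \<alpha> p t" by (simp add: is_params_def)
  fix s assume s: "is_params \<alpha> p s"
  have "s n = t n" for n
  proof (induction n rule: less_induct)
    case (less n)
    show ?case
    proof (cases "n = 0")
      case False
      have "gen_fib n (s(n := 0)) = gen_fib n (t(n := 0))"
        by (rule gen_fib_cong) (use less in auto)
      then show ?thesis
        using False gen_fib_rec[of n s] gen_fib_rec[of n t] s t by (simp add: is_params_def)
    qed (use s t in \<open>simp add: is_params_def\<close>)
  qed
  then show "s = t" by auto
qed

lemma multiplicative_fun_1:
  assumes "multiplicative_fun \<alpha>"
  shows "\<alpha> 1 = 1"
proof -
  obtain n where n: "n \<ge> 1" "\<alpha> n \<noteq> 0" using assms by (auto simp: multiplicative_fun_def)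
  have "\<alpha> (1 * n) = \<alpha> 1 * \<alpha> n"
    using assms n(1) unfolding multiplicative_fun_def by (metis coprime_1_left le_refl)
  then show ?thesis using n by simp
qed

lemma is_params_params:
  assumes "multiplicative_fun \<alpha>"
  shows "is_params \<alpha> p (params \<alpha> p)"
proof -
  have "\<exists>!t. is_params \<alpha> p t"
    using multiplicative_fun_1[OF assms] by (rule ex1_is_params)
  then show ?thesis using theI'[of "is_params \<alpha> p"] by (simp add: params_def)
qed

end

theory Submission
  imports Defs "HOL-Computational_Algebra.Polynomial_FPS"
begin

text \<open>
  Attach to \<open>\<alpha>\<close> its Bell series \<open>A = (\<Sum>n. \<alpha> (p ^ n) X ^ n)\<close>. Dirichlet convolution turns into
  multiplication of Bell series, and the parameters \<open>t\<close> are characterised by \<open>A (1 - T) = 1\<close> with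
  \<open>T = (\<Sum>j\<ge>1. t j X ^ j)\<close>, because \<open>F n = (\<Sum>j=1..n. t j F (n - j))\<close>. If both \<open>A\<close> and \<open>T\<close> are
  polynomials, comparing degrees gives \<open>A = 1\<close>. A completely multiplicative \<open>\<beta>\<close> has Bell series
  \<open>1 / (1 - \<beta> p X)\<close>, so in the positive case \<open>1 - T\<close>, and in the negative case \<open>A\<close>, is a product of
  \<open>r \<ge> 1\<close> linear polynomials, and then the other series cannot be a polynomial.
\<close>

section \<open>The linear recursion of the generalized Fibonacci polynomials\<close>

definition fib_term :: "nat \<Rightarrow> (nat \<Rightarrow> complex) \<Rightarrow> (nat \<Rightarrow> nat) \<Rightarrow> complex" where
  "fib_term N t a =
     fact (\<Sum>j=1..N. a j) / (\<Prod>j=1..N. fact (a j)) * (\<Prod>j=1..N. t j ^ a j)"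

text \<open>
  Unlike \<^const>\<open>fib_tuples\<close>, the number \<open>N\<close> of positions is decoupled from the weight \<open>n\<close>, and tuples
  are extended by \<open>0\<close>: lowering one entry then stays within the same kind of tuples.
\<close>

definition wt_tuples :: "nat \<Rightarrow> nat \<Rightarrow> (nat \<Rightarrow> nat) set" where
  "wt_tuples N n = {a. (\<forall>j. j \<notin> {1..N} \<longrightarrow> a j = 0) \<and> (\<Sum>j=1..N. j * a j) = n}"

lemma sum_fib_tuples_eq_wt_tuples:
  "(\<Sum>a\<in>fib_tuples n. fib_term n t a) = (\<Sum>a\<in>wt_tuples n n. fib_term n t a)"
proof (rule sum.reindex_bij_witness[where
      i = "\<lambda>a. restrict a {1..n}" and j = "\<lambda>a j. if j \<in> {1..n} then a j else 0"])
  fix a assume a: "a \<in> fib_tuples n"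
  then have "a \<in> extensional {1..n}" by (auto simp: fib_tuples_def PiE_def)
  then show "restrict (\<lambda>j. if j \<in> {1..n} then a j else 0) {1..n} = a"
    by (auto simp: restrict_def extensional_def)
  show "(\<lambda>j. if j \<in> {1..n} then a j else 0) \<in> wt_tuples n n"
    using a by (auto simp: fib_tuples_def wt_tuples_def)
  show "fib_term n t (\<lambda>j. if j \<in> {1..n} then a j else 0) = fib_term n t a"
    by (simp add: fib_term_def)
next
  fix a assume a: "a \<in> wt_tuples n n"
  then show "(\<lambda>j. if j \<in> {1..n} then restrict a {1..n} j else 0) = a"
    by (auto simp: wt_tuples_def)
  show "restrict a {1..n} \<in> fib_tuples n"
    using a by (auto simp: fib_tuples_def wt_tuples_def)
qed

lemma wt_tuples_entry_le:
  assumes "a \<in> wt_tuples N n"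
  shows "j * a j \<le> n"
proof (cases "j \<in> {1..N}")
  case True
  then have "j * a j \<le> (\<Sum>j=1..N. j * a j)"
    by (rule member_le_sum) auto
  then show ?thesis using assms by (simp add: wt_tuples_def)
qed (use assms in \<open>auto simp: wt_tuples_def\<close>)

lemma wt_tuples_entry_eq_0:
  assumes "a \<in> wt_tuples N n" and "n < j"
  shows "a j = 0"
  using wt_tuples_entry_le[OF assms(1), of j] assms(2) by (cases "a j") auto

text \<open>An entry at a position beyond the weight \<open>n\<close> must be 0, so allowing more
  positions adds no tuples. Thus \<open>gen_fib n\<close> and all \<open>gen_fib (n - j)\<close> can
  be summed over tuples with the same positions.\<close>

lemma wt_tuples_eq:
  assumes "n \<le> N"
  shows "wt_tuples N n = wt_tuples n n"
proof -
  have eq: "(\<Sum>j=1..N. j * a j) = (\<Sum>j=1..n. j * a j)" if "\<forall>j>n. a j = 0" for a :: "nat \<Rightarrow> nat"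
    using that assms by (intro sum.mono_neutral_right) auto
  show ?thesis
  proof (intro set_eqI iffI)
    fix a assume a: "a \<in> wt_tuples N n"
    have "\<forall>j>n. a j = 0" using wt_tuples_entry_eq_0[OF a] by auto
    then show "a \<in> wt_tuples n n" using a eq[of a] assms
      by (auto simp: wt_tuples_def not_le)
  next
    fix a assume a: "a \<in> wt_tuples n n"
    then have "\<forall>j>n. a j = 0" by (auto simp: wt_tuples_def)
    then show "a \<in> wt_tuples N n" using a eq[of a] assms
      by (auto simp: wt_tuples_def)
  qed
qed

lemma finite_wt_tuples: "finite (wt_tuples N n)"
proof (rule finite_subset)
  show "wt_tuples N n \<subseteq> {a. \<forall>j. (j \<in> {1..N} \<longrightarrow> a j \<in> {0..n}) \<and> (j \<notin> {1..N} \<longrightarrow> a j = 0)}"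
  proof
    fix a assume a: "a \<in> wt_tuples N n"
    have "a j \<le> n" if "j \<ge> 1" for j
      using wt_tuples_entry_le[OF a, of j] that by (cases j) auto
    then show "a \<in> {a. \<forall>j. (j \<in> {1..N} \<longrightarrow> a j \<in> {0..n}) \<and> (j \<notin> {1..N} \<longrightarrow> a j = 0)}"
      using a by (auto simp: wt_tuples_def)
  qed
  show "finite {a. \<forall>j. (j \<in> {1..N} \<longrightarrow> a j \<in> {0..n}) \<and> (j \<notin> {1..N} \<longrightarrow> a j = (0::nat))}"
    by (rule finite_set_of_finite_funs) auto
qed

lemma fib_term_eq:
  assumes "n \<le> N" and "\<forall>j>n. a j = 0"
  shows "fib_term N t a = fib_term n t a"
proof -
  have "(\<Sum>j=1..N. a j) = (\<Sum>j=1..n. a j)"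
    using assms by (intro sum.mono_neutral_right) auto
  moreover have "(\<Prod>j=1..N. fact (a j)) = (\<Prod>j=1..n. fact (a j) :: complex)"
    using assms by (intro prod.mono_neutral_right) auto
  moreover have "(\<Prod>j=1..N. t j ^ a j) = (\<Prod>j=1..n. t j ^ a j)"
    using assms by (intro prod.mono_neutral_right) auto
  ultimately show ?thesis by (simp add: fib_term_def)
qed

lemma gen_fib_eq_sum_wt_tuples:
  assumes "n \<le> N"
  shows "gen_fib n t = (\<Sum>a\<in>wt_tuples N n. fib_term N t a)"
proof -
  have "gen_fib n t = (\<Sum>a\<in>fib_tuples n. fib_term n t a)"
    by (simp add: gen_fib_def fib_term_def)
  also have "\<dots> = (\<Sum>a\<in>wt_tuples N n. fib_term n t a)"
    by (simp add: sum_fib_tuples_eq_wt_tuples wt_tuples_eq[OF assms])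
  also have "\<dots> = (\<Sum>a\<in>wt_tuples N n. fib_term N t a)"
    using wt_tuples_entry_eq_0[of _ N n] fib_term_eq[OF assms]
    by (intro sum.cong) auto
  finally show ?thesis .
qed

text \<open>Raising entry \<open>j\<close> multiplies the factorial of the total by the new total,
  the denominator by \<open>Suc (b j)\<close> and the monomial by \<open>t j\<close>. The
  cross-multiplied form avoids division.\<close>

lemma fib_term_raise:
  assumes j: "j \<in> {1..N}"
  shows "of_nat (Suc (b j)) * fib_term N t (b(j := Suc (b j))) =
           of_nat (Suc (\<Sum>i=1..N. b i)) * (t j * fib_term N t b)"
proof -
  define a where "a = b(j := Suc (b j))"
  have s: "(\<Sum>i=1..N. a i) = Suc (\<Sum>i=1..N. b i)"
    using sum.remove[OF _ j, of a] sum.remove[OF _ j, of b] by (simp add: a_def)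
  have f: "(\<Prod>i=1..N. fact (a i)) = of_nat (Suc (b j)) * (\<Prod>i=1..N. fact (b i) :: complex)"
    using prod.remove[OF _ j, of "\<lambda>i. fact (a i) :: complex"]
      prod.remove[OF _ j, of "\<lambda>i. fact (b i) :: complex"] by (simp add: a_def)
  have t: "(\<Prod>i=1..N. t i ^ a i) = t j * (\<Prod>i=1..N. t i ^ b i)"
    using prod.remove[OF _ j, of "\<lambda>i. t i ^ a i"]
      prod.remove[OF _ j, of "\<lambda>i. t i ^ b i"] by (simp add: a_def)
  have nz: "(\<Prod>i=1..N. fact (b i) :: complex) \<noteq> 0" by simp
  have "of_nat (Suc (b j)) * fib_term N t a =
          of_nat (Suc (\<Sum>i=1..N. b i)) * (t j * fib_term N t b)"
    unfolding fib_term_def s f t fact_Suc using nz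
    by (simp add: field_simps del: of_nat_Suc)
  then show ?thesis by (simp only: a_def)
qed

text \<open>This is Pascal's rule for multinomial coefficients, carried along with the monomials. It
  follows by summing the raising identity over \<open>j\<close>: the entries add up to the total,
  which is nonzero and cancels.\<close>

lemma fib_term_rec:
  assumes "(\<Sum>j=1..N. a j) \<noteq> 0"
  shows "fib_term N t a =
           (\<Sum>j\<in>{1..N}. if a j = 0 then 0 else t j * fib_term N t (a(j := a j - 1)))"
proof -
  define S where "S = (\<Sum>j=1..N. a j)"
  \<comment> \<open>Both sides vanish if \<open>a j = 0\<close>; otherwise \<open>a\<close> is the
    raise at \<open>j\<close> of its own lowering.\<close>
  have step: "of_nat (a j) * fib_term N t a =
      of_nat S * (if a j = 0 then 0 else t j * fib_term N t (a(j := a j - 1)))"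
    if j: "j \<in> {1..N}" for j
  proof (cases "a j = 0")
    case False
    define b where "b = a(j := a j - 1)"
    have a: "a = b(j := Suc (b j))" using False by (auto simp: b_def)
    have "S = Suc (\<Sum>i=1..N. b i)"
      using False sum.remove[OF _ j, of a] sum.remove[OF _ j, of b] by (simp add: S_def b_def)
    moreover have "a j = Suc (b j)" using False by (simp add: b_def)
    ultimately have "of_nat (a j) * fib_term N t a = of_nat S * (t j * fib_term N t b)"
      using fib_term_raise[OF j, of b t] a by simp
    then show ?thesis using False by (simp add: b_def)
  qed simp
  have "of_nat S * fib_term N t a = (\<Sum>j\<in>{1..N}. of_nat (a j) * fib_term N t a)"
    by (simp add: S_def sum_distrib_right)
  also have "\<dots> = of_nat S *
      (\<Sum>j\<in>{1..N}. if a j = 0 then 0 else t j * fib_term N t (a(j := a j - 1)))"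
    unfolding sum_distrib_left by (rule sum.cong[OF refl step])
  finally show ?thesis
    using assms unfolding mult_cancel_left S_def[symmetric] of_nat_eq_0_iff by blast
qed

text \<open>Lowering and raising entry \<open>j\<close> are mutually inverse and change the weight
  by exactly \<open>j\<close>.\<close>

lemma sum_wt_tuples_lower:
  assumes j: "j \<in> {1..N}" "j \<le> n"
  shows "(\<Sum>a | a \<in> wt_tuples N n \<and> a j \<noteq> 0. g (a(j := a j - 1))) =
           (\<Sum>b\<in>wt_tuples N (n - j). g b)"
proof (rule sum.reindex_bij_witness[where
      i = "\<lambda>b. b(j := Suc (b j))" and j = "\<lambda>a. a(j := a j - 1)"])
  have wt: "(\<Sum>i=1..N. i * (b(j := Suc (b j))) i) = j + (\<Sum>i=1..N. i * b i)" for b :: "nat \<Rightarrow> nat"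
    using sum.remove[OF _ j(1), of "\<lambda>i. i * (b(j := Suc (b j))) i"]
      sum.remove[OF _ j(1), of "\<lambda>i. i * b i"] by simp
  {
    fix a assume "a \<in> {a. a \<in> wt_tuples N n \<and> a j \<noteq> 0}"
    then show "a(j := a j - 1) \<in> wt_tuples N (n - j)"
      using wt[of "a(j := a j - 1)"] by (auto simp: wt_tuples_def)
  next
    fix b assume "b \<in> wt_tuples N (n - j)"
    then show "b(j := Suc (b j)) \<in> {a. a \<in> wt_tuples N n \<and> a j \<noteq> 0}"
      using wt[of b] j by (auto simp: wt_tuples_def)
  }
qed auto

text \<open>Expand each summand by Pascal's rule and exchange the sums; for fixed \<open>j\<close>,
  the lowered tuples run through all tuples of weight \<open>n - j\<close>.\<close>

lemma gen_fib_linear_rec: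
  assumes n: "n \<ge> 1"
  shows "gen_fib n t = (\<Sum>j=1..n. t j * gen_fib (n - j) t)"
proof -
  have nz: "(\<Sum>j=1..n. a j) \<noteq> 0" if "a \<in> wt_tuples n n" for a
  proof
    assume "(\<Sum>j=1..n. a j) = 0"
    then have "(\<Sum>j=1..n. j * a j) = 0" by simp
    then show False using that n by (simp add: wt_tuples_def)
  qed
  have "gen_fib n t = (\<Sum>a\<in>wt_tuples n n. fib_term n t a)"
    by (rule gen_fib_eq_sum_wt_tuples) simp
  also have "\<dots> = (\<Sum>a\<in>wt_tuples n n. \<Sum>j\<in>{1..n}.
      if a j = 0 then 0 else t j * fib_term n t (a(j := a j - 1)))"
    by (rule sum.cong[OF refl fib_term_rec[OF nz]])
  also have "\<dots> = (\<Sum>j\<in>{1..n}. \<Sum>a\<in>wt_tuples n n.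
      if a j = 0 then 0 else t j * fib_term n t (a(j := a j - 1)))"
    by (rule sum.swap)
  also have "\<dots> = (\<Sum>j\<in>{1..n}. t j * gen_fib (n - j) t)"
  proof (rule sum.cong[OF refl])
    fix j assume j: "j \<in> {1..n}"
    have "(\<Sum>a\<in>wt_tuples n n. if a j = 0 then 0 else t j * fib_term n t (a(j := a j - 1))) =
        (\<Sum>a | a \<in> wt_tuples n n \<and> a j \<noteq> 0. t j * fib_term n t (a(j := a j - 1)))"
      by (intro sum.mono_neutral_cong_right finite_wt_tuples) auto
    also have "\<dots> = t j * gen_fib (n - j) t"
      using j sum_wt_tuples_lower[OF j, of n "\<lambda>b. t j * fib_term n t b"]
      by (simp add: gen_fib_eq_sum_wt_tuples[of "n - j" n] sum_distrib_left)
    finally show "(\<Sum>a\<in>wt_tuples n n.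
        if a j = 0 then 0 else t j * fib_term n t (a(j := a j - 1))) = t j * gen_fib (n - j) t" .
  qed
  finally show ?thesis .
qed

section \<open>Bell series\<close>

definition bell :: "nat \<Rightarrow> (nat \<Rightarrow> complex) \<Rightarrow> complex fps" where
  "bell p f = Abs_fps (\<lambda>k. f (p ^ k))"

lemma bell_nth [simp]: "fps_nth (bell p f) k = f (p ^ k)"
  by (simp add: bell_def)

text \<open>The divisors of \<open>p ^ k\<close> are the powers \<open>p ^ i\<close> with
  \<open>i \<le> k\<close>, so the convolution at \<open>p ^ k\<close> is a Cauchy product
  coefficient.\<close>

lemma bell_dirichlet_conv:
  assumes p: "prime p"
  shows "bell p (dirichlet_conv f g) = bell p f * bell p g"
proof (rule fps_ext)
  fix k
  have inj: "inj_on (\<lambda>i. p ^ i) {0..k}"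
    using prime_gt_1_nat[OF p] by (auto simp: inj_on_def power_inject_exp)
  have "{d. d dvd p ^ k} = (\<lambda>i. p ^ i) ` {0..k}"
    using divides_primepow_nat[OF p] by auto
  then have "dirichlet_conv f g (p ^ k) = (\<Sum>i=0..k. f (p ^ i) * g (p ^ k div p ^ i))"
    by (simp add: dirichlet_conv_def sum.reindex[OF inj])
  also have "\<dots> = (\<Sum>i=0..k. f (p ^ i) * g (p ^ (k - i)))"
    using prime_gt_0_nat[OF p] by (intro sum.cong) (auto simp: power_diff)
  finally show "fps_nth (bell p (dirichlet_conv f g)) k = fps_nth (bell p f * bell p g) k"
    by (simp add: fps_mult_nth)
qed

lemma bell_conv_id:
  assumes "prime p"
  shows "bell p conv_id = 1"
  using prime_gt_1_nat[OF assms] by (intro fps_ext) (auto simp: conv_id_def)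

lemma bell_foldr_dirichlet_conv:
  assumes "prime p"
  shows "bell p (foldr dirichlet_conv fs conv_id) = (\<Prod>f\<leftarrow>fs. bell p f)"
  by (induction fs) (simp_all add: bell_conv_id bell_dirichlet_conv assms)

text \<open>The Bell series is geometric with ratio \<beta>(p) X: its constant term is \<beta>(1) =
  1, and each further coefficient is \<beta>(p) times the previous one.\<close>

lemma bell_completely_multiplicative:
  assumes "completely_multiplicative_fun \<beta>" and p: "prime p"
  shows "bell p \<beta> * fps_of_poly [:1, - \<beta> p:] = 1"
proof (rule fps_ext)
  have mult: "\<beta> (m * n) = \<beta> m * \<beta> n" if "m \<ge> 1" "n \<ge> 1" for m n
    using assms that by (auto simp: completely_multiplicative_fun_def)
  obtain n where "n \<ge> 1" "\<beta> n \<noteq> 0"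
    using assms by (auto simp: completely_multiplicative_fun_def)
  then have 1: "\<beta> (Suc 0) = 1" using mult[of 1 n] by simp
  have Suc: "\<beta> (p * p ^ k) = \<beta> p * \<beta> (p ^ k)" for k
    using mult[of p "p ^ k"] prime_gt_0_nat[OF p] by (simp add: Suc_le_eq)
  fix k
  show "fps_nth (bell p \<beta> * fps_of_poly [:1, - \<beta> p:]) k = fps_nth 1 k"
    using 1 Suc
    by (cases k) (simp_all add: fps_of_poly_pCons fps_mult_right_const_nth algebra_simps)
qed

lemma bell_params:
  assumes "multiplicative_fun \<alpha>"
  shows "bell p \<alpha> * (1 - Abs_fps (params \<alpha> p)) = 1"
proof -
  define t where "t = params \<alpha> p"
  have t0: "t 0 = 0" and F: "\<And>n. \<alpha> (p ^ n) = gen_fib n t"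
    using is_params_params[OF assms, of p] by (simp_all add: t_def is_params_def)
  have "bell p \<alpha> = 1 + Abs_fps t * bell p \<alpha>"
  proof (rule fps_ext)
    fix n
    show "fps_nth (bell p \<alpha>) n = fps_nth (1 + Abs_fps t * bell p \<alpha>) n"
    proof (cases "n = 0")
      case True
      then show ?thesis using F[of 0] by (simp add: gen_fib_0 t0)
    next
      case False
      \<comment> \<open>The convention \<open>t 0 = 0\<close> removes the term at index 0 of the
        Cauchy product and leaves the linear recursion.\<close>
      have "(\<Sum>i=0..n. t i * gen_fib (n - i) t) = (\<Sum>i=1..n. t i * gen_fib (n - i) t)"
        by (rule sum.mono_neutral_right) (auto simp: t0 Suc_le_eq)
      then show ?thesis
        using False by (simp add: fps_mult_nth F gen_fib_linear_rec[of n])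
    qed
  qed
  then show ?thesis by (simp add: t_def algebra_simps)
qed

section \<open>Finite extent as polynomiality of power series\<close>

lemma extent_finite_iff:
  "extent_of f = Finite_Extent \<longleftrightarrow> (\<exists>P. Abs_fps f = fps_of_poly P)"
proof
  assume "extent_of f = Finite_Extent"
  then obtain N where "\<forall>n\<ge>N. f n = 0"
    by (auto simp: extent_of_def split: if_splits)
  then have "\<forall>\<^sub>\<infinity>n. f n = 0" by (auto simp: MOST_nat_le)
  then have "Abs_fps f = fps_of_poly (Abs_poly f)"
    by (intro fps_ext) (simp add: Abs_poly_inverse)
  then show "\<exists>P. Abs_fps f = fps_of_poly P" ..
next
  assume "\<exists>P. Abs_fps f = fps_of_poly P"
  then obtain P where "Abs_fps f = fps_of_poly P" ..
  then have "f n = coeff P n" for n by (metis fps_nth_Abs_fps fps_of_poly_nth)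
  then have "\<forall>n\<ge>Suc (degree P). f n = 0" by (auto simp: coeff_eq_0)
  then show "extent_of f = Finite_Extent" unfolding extent_of_def by auto
qed

lemma extent_not_finite: "x \<noteq> Finite_Extent \<longleftrightarrow> x = Infinite_Extent"
  by (cases x) auto

text \<open>Degrees of nonzero complex polynomials add under multiplication, and 1 has degree
  0.\<close>

lemma degree_eq_0_of_fps_inverse:
  fixes P :: "complex poly"
  assumes "fps_of_poly P * fps_of_poly Q = 1"
  shows "degree P = 0" and "degree Q = 0"
proof -
  have PQ: "P * Q = 1"
    using assms by (metis fps_of_poly_mult fps_of_poly_1 fps_of_poly_eq_iff)
  then have "P \<noteq> 0" "Q \<noteq> 0" by auto
  then show "degree P = 0" "degree Q = 0"
    using degree_mult_eq[of P Q] PQ by auto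
qed

lemma type_at_fst_finite:
  "fst (type_at \<alpha> p) = Finite_Extent \<longleftrightarrow> (\<exists>P. bell p \<alpha> = fps_of_poly P)"
  by (simp add: type_at_def bell_def extent_finite_iff)

lemma type_at_snd_finite:
  "snd (type_at \<alpha> p) = Finite_Extent \<longleftrightarrow> (\<exists>Q. 1 - Abs_fps (params \<alpha> p) = fps_of_poly Q)"
proof -
  have "snd (type_at \<alpha> p) = Finite_Extent \<longleftrightarrow> (\<exists>P. Abs_fps (params \<alpha> p) = fps_of_poly P)"
    by (simp add: type_at_def extent_finite_iff)
  also have "\<dots> \<longleftrightarrow> (\<exists>Q. 1 - Abs_fps (params \<alpha> p) = fps_of_poly Q)"
  proof (intro iffI; elim exE)
    fix P assume "Abs_fps (params \<alpha> p) = fps_of_poly P"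
    then have "1 - Abs_fps (params \<alpha> p) = fps_of_poly (1 - P)" by (simp add: fps_of_poly_diff)
    then show "\<exists>Q. 1 - Abs_fps (params \<alpha> p) = fps_of_poly Q" ..
  next
    fix Q assume Q: "1 - Abs_fps (params \<alpha> p) = fps_of_poly Q"
    have "Abs_fps (params \<alpha> p) = 1 - (1 - Abs_fps (params \<alpha> p))" by simp
    also have "\<dots> = fps_of_poly (1 - Q)" by (simp add: Q fps_of_poly_diff)
    finally show "\<exists>P. Abs_fps (params \<alpha> p) = fps_of_poly P" ..
  qed
  finally show ?thesis .
qed

section \<open>Bell series of positive and negative functions\<close>

text \<open>\<open>Q\<close> is the product of the inverses 1 - \<beta>(p) X of the factors. Each
  has degree exactly 1 because \<beta>(p) is nonzero, so the degree of \<open>Q\<close> is the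
  number of factors, which is positive.\<close>

lemma bell_positive:
  assumes p: "prime p" and "positive_at \<alpha> p"
  obtains Q where "degree Q > 0" and "bell p \<alpha> * fps_of_poly Q = 1"
proof -
  obtain \<beta>s where ne: "\<beta>s \<noteq> []"
    and \<beta>: "\<forall>\<beta>\<in>set \<beta>s. completely_multiplicative_fun \<beta> \<and> \<beta> p \<noteq> 0"
    and \<alpha>: "\<And>k. \<alpha> (p ^ k) = foldr dirichlet_conv \<beta>s conv_id (p ^ k)"
    using assms by (auto simp: positive_at_def)
  have "bell p \<alpha> = bell p (foldr dirichlet_conv \<beta>s conv_id)"
    by (intro fps_ext) (simp add: \<alpha>)
  then have A: "bell p \<alpha> = (\<Prod>f\<leftarrow>\<beta>s. bell p f)"
    by (simp add: bell_foldr_dirichlet_conv[OF p])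
  define Q where "Q = (\<Prod>f\<leftarrow>\<beta>s. [:1, - f p:])"
  \<comment> \<open>The clause \<open>Q \<noteq> 0\<close> is carried through the induction because
    additivity of degrees requires nonzero factors.\<close>
  have "(\<Prod>f\<leftarrow>\<beta>s. bell p f) * fps_of_poly Q = 1 \<and> degree Q = length \<beta>s \<and> Q \<noteq> 0"
    unfolding Q_def using \<beta>
  proof (induction \<beta>s)
    case (Cons f fs)
    define R where "R = (\<Prod>f\<leftarrow>fs. [:1, - f p:])"
    have IH: "(\<Prod>f\<leftarrow>fs. bell p f) * fps_of_poly R = 1" "degree R = length fs" "R \<noteq> 0"
      using Cons by (simp_all add: R_def)
    have "bell p f * fps_of_poly [:1, - f p:] = 1"
      using Cons.prems p by (intro bell_completely_multiplicative) auto
    then have "bell p f * (\<Prod>f\<leftarrow>fs. bell p f) * (fps_of_poly [:1, - f p:] * fps_of_poly R) = 1"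
      using IH(1) by (metis mult.assoc mult.left_commute mult_1_right)
    moreover have "degree ([:1, - f p:] * R) = Suc (length fs)"
      using Cons.prems IH by (subst degree_mult_eq) auto
    ultimately show ?case using IH(3)
      by (simp add: fps_of_poly_mult del: mult_pCons_left flip: R_def)
  qed simp
  then show ?thesis using that[of Q] ne A by simp
qed

text \<open>Both \<open>bell p \<alpha>\<close> and the polynomial attached to the positive function
  \<gamma> are inverse to \<open>bell p \<gamma>\<close>, hence equal.\<close>

lemma bell_negative:
  assumes p: "prime p" and "negative_at \<alpha> p"
  obtains Q where "degree Q > 0" and "bell p \<alpha> = fps_of_poly Q"
proof -
  obtain \<gamma> where \<gamma>: "positive_at \<gamma> p"
    and inv: "\<And>k. dirichlet_conv \<alpha> \<gamma> (p ^ k) = conv_id (p ^ k)"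
    using assms by (auto simp: negative_at_def)
  obtain Q where Q: "degree Q > 0" "bell p \<gamma> * fps_of_poly Q = 1"
    using bell_positive[OF p \<gamma>] .
  have "bell p (dirichlet_conv \<alpha> \<gamma>) = bell p conv_id"
    by (intro fps_ext) (simp add: inv)
  then have "bell p \<alpha> * bell p \<gamma> = 1"
    by (simp add: bell_dirichlet_conv bell_conv_id p)
  then have "bell p \<alpha> = fps_of_poly Q"
    using Q(2) by (metis mult.assoc mult_1_left mult_1_right)
  then show ?thesis using that Q(1) by blast
qed

theorem theorem10:
  fixes p :: nat and \<alpha> :: "nat \<Rightarrow> complex"
  assumes "prime p" and "multiplicative_fun \<alpha>"
  shows "(type_at \<alpha> p = (Finite_Extent, Finite_Extent) \<longleftrightarrow> (\<forall>n\<ge>1. \<alpha> (p ^ n) = 0)) \<and>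
         (positive_at \<alpha> p \<longrightarrow> type_at \<alpha> p = (Infinite_Extent, Finite_Extent)) \<and>
         (negative_at \<alpha> p \<longrightarrow> type_at \<alpha> p = (Finite_Extent, Infinite_Extent))"
proof (intro conjI impI iffI)
  define A where "A = bell p \<alpha>"
  define U where "U = 1 - Abs_fps (params \<alpha> p)"
  have AU: "A * U = 1" using bell_params[OF assms(2)] by (simp add: A_def U_def)
  have fst_fin: "fst (type_at \<alpha> p) = Finite_Extent \<longleftrightarrow> (\<exists>P. A = fps_of_poly P)"
    by (simp add: type_at_fst_finite A_def)
  have snd_fin: "snd (type_at \<alpha> p) = Finite_Extent \<longleftrightarrow> (\<exists>Q. U = fps_of_poly Q)"
    by (simp add: type_at_snd_finite U_def)
  {
    assume "type_at \<alpha> p = (Finite_Extent, Finite_Extent)"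
    then obtain P Q where PQ: "A = fps_of_poly P" "U = fps_of_poly Q"
      using fst_fin snd_fin by auto
    \<comment> \<open>A constant \<open>P\<close> leaves no coefficient of \<open>A\<close> from
      index 1 on.\<close>
    then have "degree P = 0" using AU degree_eq_0_of_fps_inverse by metis
    then show "\<forall>n\<ge>1. \<alpha> (p ^ n) = 0"
      using PQ(1) by (metis A_def bell_nth coeff_eq_0 fps_of_poly_nth less_le_trans zero_less_one)
  next
    assume 0: "\<forall>n\<ge>1. \<alpha> (p ^ n) = 0"
    have A: "A = 1"
    proof (rule fps_ext)
      fix n
      show "fps_nth A n = fps_nth 1 n"
        using 0 multiplicative_fun_1[OF assms(2)] by (cases n) (auto simp: A_def)
    qed
    then have "U = 1" using AU by simp
    then show "type_at \<alpha> p = (Finite_Extent, Finite_Extent)"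
      using A fst_fin snd_fin by (metis fps_of_poly_1 prod.collapse)
  next
    assume "positive_at \<alpha> p"
    then obtain Q where Q: "degree Q > 0" "A * fps_of_poly Q = 1"
      using bell_positive[OF assms(1)] by (metis A_def)
    \<comment> \<open>Inverses of \<open>A\<close> are unique, which settles the domain.\<close>
    have "U = fps_of_poly Q" using AU Q(2) by (metis mult.assoc mult.commute mult_1_left)
    \<comment> \<open>A polynomial \<open>A\<close> would be inverse to \<open>Q\<close> and force
      \<open>Q\<close> to be constant.\<close>
    moreover have "\<nexists>P. A = fps_of_poly P"
      using Q degree_eq_0_of_fps_inverse by (metis less_irrefl)
    ultimately show "type_at \<alpha> p = (Infinite_Extent, Finite_Extent)"
      using fst_fin snd_fin by (metis extent_not_finite prod.collapse)
  next
    assume "negative_at \<alpha> p"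
    then obtain Q where Q: "degree Q > 0" "A = fps_of_poly Q"
      using bell_negative[OF assms(1)] by (metis A_def)
    \<comment> \<open>Now \<open>A\<close> is the nonconstant polynomial, and a polynomial inverse
      \<open>U\<close> would make it constant.\<close>
    then have "\<nexists>P. U = fps_of_poly P"
      using AU degree_eq_0_of_fps_inverse by (metis less_irrefl)
    then show "type_at \<alpha> p = (Finite_Extent, Infinite_Extent)"
      using Q(2) fst_fin snd_fin by (metis extent_not_finite prod.collapse)
  }
qed

end
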